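(* Let $\Gamma$ be an $r$-dimensional linear subspace of $\mathbb{R}^d$ ($r \ge 1$), let $\delta > 0$, and let $f : \mathbb{R}^d \to \mathbb{R}$ be $\Gamma$-invariant and $G$-Lipschitz. Let $f_{\delta,\Gamma} = S_{\delta,\Gamma} f$ be the smoothing of $f$. Then: 1. $f_{\delta,\Gamma}$ is differentiable, and is also $G$-Lipschitz and $\Gamma$-invariant. 2. $\nabla f_{\delta,\Gamma}$ is $\frac{rG}{\delta}$-Lipschitz. 3. For all $x \in \mathbb{R}^d$, $|f_{\delta,\Gamma}(x) - f(x)| \le \delta G$.
   Context: All norms are Euclidean and Lipschitzness is with respect to the Euclidean norm. A function $f : \mathbb{R}^d \to \mathbb{R}$ is $\Gamma$-invariant if $f(x) = f(x+y)$ for all $x \in \mathbb{R}^d$ and all $y \in \Gamma^\perp$ (the orthogonal complement of $\Gamma$). The smoothing operator $S_{\delta,\Gamma}$ maps functions $\mathbb{R}^d \to \mathbb{R}$ to functions $\mathbb{R}^d \to \mathbb{R}$ by $$S_{\delta,\Gamma} f(x) = \mathbb{E}_{v \in \Gamma, \|v\| \le 1}[f(x + \delta v)],$$ where $v$ is uniformly distributed on the unit ball $\{v \in \Gamma : \|v\| \le 1\}$ of $\Gamma$ (with respect to $r$-dimensional Lebesgue measure on $\Gamma$). *)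

theory Defs
  imports "HOL-Analysis.Analysis"
begin

definition orthonormal_basis_of :: "'a::euclidean_space set \<Rightarrow> 'a set \<Rightarrow> bool" where
  "orthonormal_basis_of \<Gamma> B \<longleftrightarrow>
     pairwise orthogonal B \<and> (\<forall>b\<in>B. norm b = 1) \<and> span B = \<Gamma>"

lemma orthonormal_basis_of_exists:
  assumes "subspace \<Gamma>"
  shows "\<exists>B. orthonormal_basis_of \<Gamma> B"
  using orthonormal_basis_subspace[OF assms] unfolding orthonormal_basis_of_def by metis

text \<open>
  The Lebesgue measure of dimension \<open>dim \<Gamma>\<close> on a subspace \<open>\<Gamma>\<close>, regarded as a Borel
  measure on the ambient space that is concentrated on \<open>\<Gamma>\<close>. It is the image of the
  product Lebesgue measure under the isometric coordinates of an orthonormal basis of \<open>\<Gamma>\<close>,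
  as in the definition of \<^const>\<open>lborel\<close>; since Lebesgue measure is rotation invariant, the
  result does not depend on which orthonormal basis is chosen.
\<close>
definition subspace_lborel :: "'a::euclidean_space set \<Rightarrow> 'a measure" where
  "subspace_lborel \<Gamma> =
     (let B = (SOME B. orthonormal_basis_of \<Gamma> B)
      in distr (\<Pi>\<^sub>M b\<in>B. (lborel :: real measure)) borel (\<lambda>c. \<Sum>b\<in>B. c b *\<^sub>R b))"

definition smoothing ::
  "real \<Rightarrow> 'a::euclidean_space set \<Rightarrow> ('a \<Rightarrow> real) \<Rightarrow> 'a \<Rightarrow> real" where
  "smoothing \<delta> \<Gamma> f x =
     (\<integral>v. f (x + \<delta> *\<^sub>R v) \<partial>uniform_measure (subspace_lborel \<Gamma>) {v \<in> \<Gamma>. norm v \<le> 1})"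

definition subspace_invariant :: "'a::euclidean_space set \<Rightarrow> ('a \<Rightarrow> real) \<Rightarrow> bool" where
  "subspace_invariant \<Gamma> f \<longleftrightarrow> (\<forall>x. \<forall>y\<in>orthogonal_comp \<Gamma>. f x = f (x + y))"

text \<open>Only meaningful at points of differentiability; see the next two lemmas.\<close>
definition gradient :: "('a::euclidean_space \<Rightarrow> real) \<Rightarrow> 'a \<Rightarrow> 'a" where
  "gradient f x = (THE D. GDERIV f x :> D)"

lemma gradient_eqI:
  assumes "GDERIV f x :> D"
  shows "gradient f x = D"
  unfolding gradient_def
proof (rule the_equality)
  show "GDERIV f x :> D" by (fact assms)
next
  fix D' assume "GDERIV f x :> D'"
  with assms have "(\<lambda>h. inner h D') = (\<lambda>h. inner h D)"
    unfolding gderiv_def by (metis has_derivative_unique)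
  then have "\<forall>h. inner h D' = inner h D" by metis
  then show "D' = D" by (simp add: vector_eq_ldot)
qed

lemma GDERIV_gradient:
  assumes "f differentiable (at x)"
  shows "GDERIV f x :> gradient f x"
proof -
  obtain f' where f': "(f has_derivative f') (at x)"
    using assms unfolding differentiable_def by blast
  then interpret bounded_linear f' by (rule has_derivative_bounded_linear)
  have "f' = (\<lambda>h. inner h (adjoint f' 1))"
    using adjoint_works[OF linear_axioms, of _ 1] by (auto simp: fun_eq_iff)
  with f' have "GDERIV f x :> adjoint f' 1" unfolding gderiv_def by metis
  then show ?thesis using gradient_eqI by metis
qed

end

theory Submission
  imports Defs "HOL-Probability.Probability_Measure"
begin

text \<open>
  Write \<open>F\<close> for the smoothing of \<open>f\<close>, and \<open>L = r * G / \<delta>\<close>. Invariance, the Lipschitz bound for \<open>F\<close>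
  and the distance bound come from averaging the corresponding inequalities for \<open>f\<close> over the
  unit ball of \<open>\<Gamma>\<close>. The substance lies in the differentiability of \<open>F\<close> and in the constant \<open>L\<close>.
  The textbook route writes the gradient of \<open>F\<close> as an average over the unit sphere, by the
  divergence theorem. The proof below needs neither surface measure nor derivatives of \<open>f\<close>:
  it rests on the second difference estimate

  \<open>\<bar>F (x + h + k) - F (x + h) - F (x + k) + F x\<bar> \<le> L * norm h * norm k\<close>.

  This estimate has a measure-theoretic reason. For fixed \<open>k\<close> the increment
  \<open>g y = f (y + k) - f y\<close> is bounded by \<open>G * norm k\<close>, and the second difference is an increment
  of the smoothing of \<open>g\<close>. Invariance allows replacing \<open>h\<close> by its projection onto \<open>\<Gamma>\<close>.
  The smoothing of \<open>g\<close> at \<open>x\<close> and at \<open>x + h\<close> averages \<open>g\<close> over two balls of radius \<open>\<delta>\<close>,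
  so only their symmetric difference matters. In units of \<open>\<delta>\<close>, with \<open>a = norm h / \<delta>\<close>, it lies
  between the balls of radius \<open>1 - a / 2\<close> and \<open>1 + a / 2\<close> around the midpoint, so
  its volume relative to the unit ball is at most \<open>(1 + a / 2)^r - (1 - a / 2)^r\<close>, which is
  \<open>r * a\<close> to first order (\<open>smoothing_bounded_translation_estimate\<close>). Cutting \<open>h\<close> into many small steps
  removes the higher-order terms (\<open>smoothing_bounded_lipschitz_along\<close>).

  A Lipschitz function whose second differences satisfy such an estimate is differentiable with
  \<open>L\<close>-Lipschitz gradient (\<open>second_difference_bound_imp_lipschitz_gradient\<close>): its dyadic difference
  quotients form a Cauchy sequence, and their limit is additive in the direction.
\<close>

section \<open>Differentiability from second differences\<close>

text \<open>
  Additivity gives homogeneity over the integers. For real \<open>t\<close>, the integer part of \<open>n * t\<close>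
  cancels in \<open>n * (A (t *\<^sub>R k) - t * A k)\<close>, so this quantity is bounded independently of \<open>n\<close>.
\<close>
lemma additive_bounded_imp_bounded_linear:
  fixes A :: "'a::real_normed_vector \<Rightarrow> real"
  assumes add: "\<And>h k. A (h + k) = A h + A k"
    and bound: "\<And>k. \<bar>A k\<bar> \<le> C * norm k"
  shows "bounded_linear A"
proof -
  have zero: "A 0 = 0"
    using add[of 0 0] by simp
  have minus: "A (- k) = - A k" for k
    using add[of k "- k"] zero by simp
  have nat: "A (real n *\<^sub>R k) = real n * A k" for n k
    by (induction n) (simp_all add: zero add algebra_simps)
  have int: "A (of_int i *\<^sub>R k) = of_int i * A k" for i k
  proof (cases i)
    case (nonneg n)
    then show ?thesis using nat[of n k] by simp
  next
    case (neg n)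
    have i: "of_int i = - real (Suc n)"
      using neg by simp
    show ?thesis
      unfolding i scaleR_minus_left minus nat by (rule mult_minus_left[symmetric])
  qed
  have scale: "A (t *\<^sub>R k) = t * A k" for t k
  proof -
    have C: "0 \<le> C * norm k"
      using bound[of k] by linarith
    have est: "real n * \<bar>A (t *\<^sub>R k) - t * A k\<bar> \<le> 2 * (C * norm k)" for n
    proof -
      define s where "s = frac (real n * t)"
      have s: "0 \<le> s" "s \<le> 1" "real n * t = of_int \<lfloor>real n * t\<rfloor> + s"
        using frac_lt_1[of "real n * t"] by (auto simp: s_def frac_def)
      have "real n * A (t *\<^sub>R k) = A ((real n * t) *\<^sub>R k)"
        using nat[of n "t *\<^sub>R k"] by simp
      also have "\<dots> = of_int \<lfloor>real n * t\<rfloor> * A k + A (s *\<^sub>R k)"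
        by (subst s(3)) (simp only: scaleR_add_left add int)
      finally have "real n * (A (t *\<^sub>R k) - t * A k) = A (s *\<^sub>R k) - s * A k"
        using arg_cong[OF s(3), of "\<lambda>u. u * A k"] by (simp add: distrib_right right_diff_distrib)
      moreover have "\<bar>A (s *\<^sub>R k)\<bar> \<le> C * norm k"
      proof -
        have "\<bar>A (s *\<^sub>R k)\<bar> \<le> s * (C * norm k)"
          using bound[of "s *\<^sub>R k"] s by (simp add: ac_simps)
        also have "\<dots> \<le> C * norm k"
          using s C mult_right_mono[of s 1 "C * norm k"] by simp
        finally show ?thesis .
      qed
      moreover have "\<bar>s * A k\<bar> \<le> C * norm k"
      proof -
        have "\<bar>s * A k\<bar> \<le> 1 * (C * norm k)"
          unfolding abs_mult using s bound[of k] by (intro mult_mono) auto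
        then show ?thesis by simp
      qed
      ultimately have "\<bar>real n * (A (t *\<^sub>R k) - t * A k)\<bar> \<le> 2 * (C * norm k)"
        by linarith
      then show ?thesis by (simp add: abs_mult)
    qed
    show ?thesis
    proof (rule ccontr)
      assume "A (t *\<^sub>R k) \<noteq> t * A k"
      then have "0 < \<bar>A (t *\<^sub>R k) - t * A k\<bar>" by simp
      then obtain n where "2 * (C * norm k) < real n * \<bar>A (t *\<^sub>R k) - t * A k\<bar>"
        using reals_Archimedean3 by blast
      with est[of n] show False by linarith
    qed
  qed
  show ?thesis
    by (rule bounded_linear_intro[where K = C]) (use add scale bound in \<open>auto simp: mult.commute\<close>)
qed

text \<open>
  The derivative at \<open>x\<close> in direction \<open>k\<close> is constructed as the limit \<open>A x k\<close> of the difference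
  quotients \<open>D x k n\<close> with step \<open>1 / 2 ^ n\<close>. Halving the step changes the quotient by a
  second difference with both increments equal to the new step, hence by
  \<open>O(1 / 2 ^ n)\<close>. Summing these changes bounds the distance of \<open>A x k\<close> from
  \<open>F (x + k) - F x\<close> quadratically in \<open>k\<close>, which makes \<open>A x\<close> a Frechet derivative as soon as it is linear.
  Additivity in \<open>k\<close> and the Lipschitz dependence on \<open>x\<close> are both second difference bounds
  passed to the limit.
\<close>
proposition second_difference_bound_imp_lipschitz_gradient:
  fixes F :: "'a::euclidean_space \<Rightarrow> real"
  assumes second: "\<And>x h k. \<bar>F (x + h + k) - F (x + h) - F (x + k) + F x\<bar> \<le> L * norm h * norm k"
    and L: "0 \<le> L"
    and lip: "C-lipschitz_on UNIV F"
  shows "F differentiable (at x)" and "L-lipschitz_on UNIV (gradient F)"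
proof -
  define D where "D x k n = 2 ^ n * (F (x + (1 / 2 ^ n) *\<^sub>R k) - F x)" for x k and n :: nat
  have step: "\<bar>D x k (Suc n) - D x k n\<bar> \<le> (L * (norm k)\<^sup>2 / 4) * (1 / 2) ^ n" for x k n
  proof -
    define h where "h = (1 / 2 ^ Suc n) *\<^sub>R k"
    have "(1 / 2 ^ n) *\<^sub>R k = h + h"
      unfolding h_def scaleR_add_left[symmetric] by (simp add: field_simps)
    then have "D x k (Suc n) - D x k n = - (2 ^ n * (F (x + h + h) - F (x + h) - F (x + h) + F x))"
      unfolding D_def h_def[symmetric] by (simp add: algebra_simps)
    then have "\<bar>D x k (Suc n) - D x k n\<bar> = 2 ^ n * \<bar>F (x + h + h) - F (x + h) - F (x + h) + F x\<bar>"
      by (simp add: abs_mult)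
    also have "\<dots> \<le> 2 ^ n * (L * norm h * norm h)"
      by (intro mult_left_mono second) auto
    also have "\<dots> = (L * (norm k)\<^sup>2 / 4) * (1 / 2) ^ n"
      unfolding h_def by (simp add: field_simps power2_eq_square)
    finally show ?thesis .
  qed
  define A where "A x k = D x k 0 + (\<Sum>n. D x k (Suc n) - D x k n)" for x k
  have lim: "(\<lambda>n. D x k n) \<longlonglongrightarrow> A x k" for x k
  proof -
    have "summable (\<lambda>n. (L * (norm k)\<^sup>2 / 4) * (1 / 2) ^ n)"
      by (intro summable_mult summable_geometric) simp
    then have "summable (\<lambda>n. D x k (Suc n) - D x k n)"
      by (rule summable_comparison_test') (use step in auto)
    then have "(\<lambda>n. D x k 0 + (\<Sum>i<n. D x k (Suc i) - D x k i)) \<longlonglongrightarrow> A x k"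
      unfolding A_def by (intro tendsto_add tendsto_const summable_LIMSEQ)
    then show ?thesis
      by (simp add: sum_lessThan_telescope)
  qed
  have quadratic: "\<bar>F (x + k) - F x - A x k\<bar> \<le> (L / 2) * (norm k)\<^sup>2" for x k
  proof -
    have "\<bar>D x k n - D x k 0\<bar> \<le> (L * (norm k)\<^sup>2 / 2) * (1 - (1 / 2) ^ n)" for n
    proof (induction n)
      case (Suc n)
      have "\<bar>D x k (Suc n) - D x k 0\<bar>
          \<le> (L * (norm k)\<^sup>2 / 4) * (1 / 2) ^ n + (L * (norm k)\<^sup>2 / 2) * (1 - (1 / 2) ^ n)"
        using Suc step[of x k n] by linarith
      also have "\<dots> = (L * (norm k)\<^sup>2 / 2) * (1 - (1 / 2) ^ Suc n)"
        by (simp add: field_simps)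
      finally show ?case .
    qed simp
    moreover have "(L * (norm k)\<^sup>2 / 2) * (1 - (1 / 2) ^ n) \<le> (L / 2) * (norm k)\<^sup>2" for n :: nat
      using L by (simp add: field_simps)
    ultimately have "\<bar>D x k n - D x k 0\<bar> \<le> (L / 2) * (norm k)\<^sup>2" for n
      using order_trans by blast
    moreover have "(\<lambda>n. \<bar>D x k n - D x k 0\<bar>) \<longlonglongrightarrow> \<bar>A x k - D x k 0\<bar>"
      by (intro tendsto_intros lim)
    ultimately have "\<bar>A x k - D x k 0\<bar> \<le> (L / 2) * (norm k)\<^sup>2"
      by (intro Lim_bounded[where M = 0]) auto
    then show ?thesis
      unfolding D_def by (simp add: abs_minus_commute)
  qed
  have vanish: "(\<lambda>n. c * (1 / 2) ^ n) \<longlonglongrightarrow> 0" for c :: real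
    using tendsto_mult_right_zero[OF LIMSEQ_power_zero[of "1 / 2 :: real"]] by simp
  have additive: "A x (h + k) = A x h + A x k" for x h k
  proof -
    have "\<bar>D x (h + k) n - D x h n - D x k n\<bar> \<le> (L * norm h * norm k) * (1 / 2) ^ n" for n
    proof -
      define c :: real where "c = 1 / 2 ^ n"
      have c: "2 ^ n * c = 1" "0 < c" "c = (1 / 2) ^ n" by (auto simp: c_def field_simps)
      have "D x (h + k) n - D x h n - D x k n
          = 2 ^ n * (F (x + c *\<^sub>R h + c *\<^sub>R k) - F (x + c *\<^sub>R h) - F (x + c *\<^sub>R k) + F x)"
        unfolding D_def c_def[symmetric] by (simp add: algebra_simps)
      then have "\<bar>D x (h + k) n - D x h n - D x k n\<bar>
          \<le> 2 ^ n * (L * norm (c *\<^sub>R h) * norm (c *\<^sub>R k))"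
        using second[of x "c *\<^sub>R h" "c *\<^sub>R k"] by (simp add: abs_mult)
      also have "\<dots> = (2 ^ n * c) * ((L * norm h * norm k) * c)"
        using c(2) by simp
      finally show ?thesis using c by simp
    qed
    then have "(\<lambda>n. D x (h + k) n - D x h n - D x k n) \<longlonglongrightarrow> 0"
      by (intro Lim_null_comparison[OF _ vanish[of "L * norm h * norm k"]]) auto
    moreover have "(\<lambda>n. D x (h + k) n - D x h n - D x k n) \<longlonglongrightarrow> A x (h + k) - A x h - A x k"
      by (intro tendsto_intros lim)
    ultimately have "A x (h + k) - A x h - A x k = 0"
      using LIMSEQ_unique by blast
    then show ?thesis by simp
  qed
  have bound: "\<bar>A x k\<bar> \<le> C * norm k" for x k
  proof -
    have "\<bar>D x k n\<bar> \<le> C * norm k" for n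
    proof -
      have "\<bar>F (x + (1 / 2 ^ n) *\<^sub>R k) - F x\<bar> \<le> C * ((1 / 2 ^ n) * norm k)"
        using lipschitz_onD[OF lip, of "x + (1 / 2 ^ n) *\<^sub>R k" x] by (simp add: dist_norm)
      then have "2 ^ n * \<bar>F (x + (1 / 2 ^ n) *\<^sub>R k) - F x\<bar> \<le> C * norm k"
        by (simp add: field_simps)
      then show ?thesis
        unfolding D_def by (simp add: abs_mult)
    qed
    then show ?thesis
      by (intro Lim_bounded[OF tendsto_rabs[OF lim], of 0]) auto
  qed
  have deriv: "(F has_derivative A x) (at x)" for x
  proof (rule has_derivativeI_sandwich[of 1])
    show "bounded_linear (A x)"
      by (rule additive_bounded_imp_bounded_linear[OF additive bound])
    show "norm (F y - F x - A x (y - x)) / norm (y - x) \<le> (L / 2) * norm (y - x)"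
      if "y \<noteq> x" for y
      using quadratic[of x "y - x"] that by (simp add: field_simps power2_eq_square)
    have "((\<lambda>y. (L / 2) * norm (y - x)) \<longlongrightarrow> (L / 2) * norm (x - x)) (at x)"
      by (intro tendsto_intros)
    then show "((\<lambda>y. (L / 2) * norm (y - x)) \<longlongrightarrow> 0) (at x)" by simp
  qed simp
  then show diff: "F differentiable (at x)" for x
    unfolding differentiable_def by blast
  have A_gradient: "A x k = k \<bullet> gradient F x" for x k
    using has_derivative_unique[OF deriv GDERIV_gradient[OF diff, unfolded gderiv_def]] by meson
  have A_lipschitz: "\<bar>A (x + h) k - A x k\<bar> \<le> L * norm h * norm k" for x h k
  proof -
    have "\<bar>D (x + h) k n - D x k n\<bar> \<le> L * norm h * norm k" for n
    proof -
      define c :: real where "c = 1 / 2 ^ n"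
      have c: "2 ^ n * c = 1" "0 < c" by (auto simp: c_def)
      have "D (x + h) k n - D x k n
          = 2 ^ n * (F (x + h + c *\<^sub>R k) - F (x + h) - F (x + c *\<^sub>R k) + F x)"
        unfolding D_def c_def[symmetric] by (simp add: algebra_simps)
      then have "\<bar>D (x + h) k n - D x k n\<bar> \<le> 2 ^ n * (L * norm h * norm (c *\<^sub>R k))"
        using second[of x h "c *\<^sub>R k"] by (simp add: abs_mult)
      also have "\<dots> = (2 ^ n * c) * (L * norm h * norm k)"
        using c(2) by simp
      finally show ?thesis using c by simp
    qed
    then show ?thesis
      by (intro Lim_bounded[OF tendsto_rabs[OF tendsto_diff[OF lim lim]], of 0]) auto
  qed
  show "L-lipschitz_on UNIV (gradient F)"
  proof (rule lipschitz_onI[OF _ L])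
    fix x y
    \<comment> \<open>Testing the derivatives on the direction of the gradient difference itself gives its norm.\<close>
    define w where "w = gradient F x - gradient F y"
    have "w \<bullet> w = A x w - A y w"
      unfolding A_gradient by (simp add: w_def inner_diff_right)
    then have "norm w * norm w \<le> (L * norm (x - y)) * norm w"
      using A_lipschitz[of y "x - y" w] by (simp add: norm_eq_sqrt_inner)
    then have "norm w \<le> L * norm (x - y)"
      using L by (cases "w = 0") auto
    then show "dist (gradient F x) (gradient F y) \<le> L * dist x y"
      by (simp add: dist_norm w_def)
  qed
qed

section \<open>Lebesgue measure on a subspace\<close>

lemma emeasure_lborel_affine:
  fixes A :: "real set"
  assumes "A \<in> sets borel" and "0 < s"
  shows "emeasure lborel A = ennreal s * emeasure lborel {x. s * x + t \<in> A}"
proof -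
  have "emeasure lborel A = emeasure (density (distr lborel borel (\<lambda>x. t + s * x)) (\<lambda>_. ennreal \<bar>s\<bar>)) A"
    using lborel_real_affine[of s t] assms by simp
  also have "\<dots> = ennreal s * emeasure lborel {x. s * x + t \<in> A}"
    using assms by (simp add: emeasure_density_const emeasure_distr vimage_def add.commute)
  finally show ?thesis .
qed

lemma PiM_lborel_affine:
  fixes t :: "'i \<Rightarrow> real"
  assumes fin: "finite B" and s: "0 < s"
  defines "P \<equiv> PiM B (\<lambda>_. lborel :: real measure)"
  shows "P = scale_measure (ennreal (s ^ card B)) (distr P P (\<lambda>c. \<lambda>b\<in>B. s * c b + t b))"
    (is "_ = scale_measure _ (distr P P ?T)")
proof -
  interpret product_sigma_finite "\<lambda>_::'i. lborel :: real measure"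
    by standard
  have T[measurable]: "?T \<in> measurable P P"
    unfolding P_def by measurable
  show ?thesis
    unfolding P_def
  proof (rule PiM_eqI[OF fin, symmetric], unfold P_def[symmetric])
    show "sets (scale_measure (ennreal (s ^ card B)) (distr P P ?T)) = sets P" by simp
  next
    fix A assume A: "\<And>b. b \<in> B \<Longrightarrow> A b \<in> sets (lborel :: real measure)"
    have A': "{x. s * x + t b \<in> A b} \<in> sets borel" if "b \<in> B" for b
      using measurable_sets[of "\<lambda>x. s * x + t b" borel borel "A b"] A[OF that]
      by (simp add: vimage_def)
    have "?T -` Pi\<^sub>E B A \<inter> space P = (\<Pi>\<^sub>E b\<in>B. {x. s * x + t b \<in> A b})"
      by (auto simp: P_def space_PiM PiE_iff extensional_def)
    moreover have "Pi\<^sub>E B A \<in> sets P"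
      unfolding P_def using A by (intro sets_PiM_I_finite fin) auto
    ultimately have "emeasure (distr P P ?T) (Pi\<^sub>E B A)
        = emeasure P (\<Pi>\<^sub>E b\<in>B. {x. s * x + t b \<in> A b})"
      using T by (simp add: emeasure_distr)
    also have "\<dots> = (\<Prod>b\<in>B. emeasure lborel {x. s * x + t b \<in> A b})"
      unfolding P_def using A' by (intro emeasure_PiM fin) auto
    finally have "emeasure (scale_measure (ennreal (s ^ card B)) (distr P P ?T)) (Pi\<^sub>E B A)
        = (\<Prod>b\<in>B. ennreal s) * (\<Prod>b\<in>B. emeasure lborel {x. s * x + t b \<in> A b})"
      using s by (simp add: ennreal_power)
    also have "\<dots> = (\<Prod>b\<in>B. ennreal s * emeasure lborel {x. s * x + t b \<in> A b})"
      by (simp add: prod.distrib)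
    also have "\<dots> = (\<Prod>b\<in>B. emeasure lborel (A b))"
      using emeasure_lborel_affine[OF _ s] A by (intro prod.cong) auto
    finally show "emeasure (scale_measure (ennreal (s ^ card B)) (distr P P ?T)) (Pi\<^sub>E B A)
        = (\<Prod>b\<in>B. emeasure lborel (A b))" .
  qed
qed

lemma orthonormal_basis_of_finite_card:
  assumes "orthonormal_basis_of \<Gamma> B"
  shows "finite B" and "card B = dim \<Gamma>"
proof -
  have "pairwise orthogonal B" "\<forall>b\<in>B. norm b = 1" "span B = \<Gamma>"
    using assms by (auto simp: orthonormal_basis_of_def)
  then have "independent B"
    by (intro pairwise_orthogonal_independent) auto
  then show "finite B" and "card B = dim \<Gamma>"
    using \<open>span B = \<Gamma>\<close> independent_imp_finite dim_span_eq_card_independent[of B] by auto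
qed

lemma subspace_lborel_obtain_basis:
  fixes \<Gamma> :: "'a::euclidean_space set"
  assumes "subspace \<Gamma>"
  obtains B where "orthonormal_basis_of \<Gamma> B" and
    "subspace_lborel \<Gamma> = distr (PiM B (\<lambda>_. lborel :: real measure)) borel (\<lambda>c. \<Sum>b\<in>B. c b *\<^sub>R b)"
  using someI_ex[OF orthonormal_basis_of_exists[OF assms]]
  unfolding subspace_lborel_def Let_def by blast

lemma sets_subspace_lborel [simp, measurable_cong]: "sets (subspace_lborel \<Gamma>) = sets borel"
  by (simp add: subspace_lborel_def Let_def)

lemma space_subspace_lborel [simp]: "space (subspace_lborel \<Gamma>) = UNIV"
  by (simp add: subspace_lborel_def Let_def)

text \<open>
  Translation invariance (\<open>s = 1\<close>) and scaling of the measure on \<open>\<Gamma>\<close> in one formula: in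
  orthonormal coordinates, \<open>v \<mapsto> s *\<^sub>R v + h\<close> acts on each coordinate by an affine map with slope \<open>s\<close>.
\<close>
proposition emeasure_subspace_lborel_affine:
  fixes \<Gamma> :: "'a::euclidean_space set"
  assumes \<Gamma>: "subspace \<Gamma>" and s: "0 < s" and h: "h \<in> \<Gamma>" and A: "A \<in> sets borel"
  shows "emeasure (subspace_lborel \<Gamma>) A
    = ennreal (s ^ dim \<Gamma>) * emeasure (subspace_lborel \<Gamma>) {v. s *\<^sub>R v + h \<in> A}"
proof -
  obtain B where B: "orthonormal_basis_of \<Gamma> B" and
    M: "subspace_lborel \<Gamma> = distr (PiM B (\<lambda>_. lborel :: real measure)) borel (\<lambda>c. \<Sum>b\<in>B. c b *\<^sub>R b)"
    using subspace_lborel_obtain_basis[OF \<Gamma>] by blast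
  note fin = orthonormal_basis_of_finite_card[OF B]
  define P where "P = PiM B (\<lambda>_. lborel :: real measure)"
  define \<phi> where "\<phi> c = (\<Sum>b\<in>B. c b *\<^sub>R b)" for c :: "'a \<Rightarrow> real"
  have \<phi>[measurable]: "\<phi> \<in> measurable P borel"
    unfolding \<phi>_def P_def by measurable
  obtain t where t: "h = \<phi> t"
    using h B span_finite[OF fin(1)] unfolding orthonormal_basis_of_def \<phi>_def by auto
  define T where "T c = (\<lambda>b\<in>B. s * c b + t b)" for c
  have T[measurable]: "T \<in> measurable P P"
    unfolding T_def P_def by measurable
  have \<phi>_T: "\<phi> (T c) = s *\<^sub>R \<phi> c + h" for c
    by (simp add: t \<phi>_def T_def scaleR_sum_right scaleR_add_left sum.distrib)
  have A': "{v. s *\<^sub>R v + h \<in> A} \<in> sets borel"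
    using measurable_sets[of "\<lambda>v. s *\<^sub>R v + h" borel borel A] A by (simp add: vimage_def)
  have "emeasure P (\<phi> -` A \<inter> space P)
      = emeasure (scale_measure (ennreal (s ^ card B)) (distr P P T)) (\<phi> -` A \<inter> space P)"
    using PiM_lborel_affine[OF fin(1) s, of t] unfolding P_def T_def by metis
  also have "\<dots> = ennreal (s ^ card B) * emeasure P (T -` (\<phi> -` A \<inter> space P) \<inter> space P)"
    using A by (simp add: emeasure_distr)
  also have "T -` (\<phi> -` A \<inter> space P) \<inter> space P = \<phi> -` {v. s *\<^sub>R v + h \<in> A} \<inter> space P"
    using measurable_space[OF T] by (auto simp: \<phi>_T)
  finally show ?thesis
    unfolding M P_def[symmetric] \<phi>_def[symmetric] fin(2)[symmetric]
    using A A' by (simp add: emeasure_distr)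
qed

definition subspace_cball :: "'a::euclidean_space set \<Rightarrow> 'a \<Rightarrow> real \<Rightarrow> 'a set" where
  "subspace_cball \<Gamma> c R = {v \<in> \<Gamma>. norm (v - c) \<le> R}"

lemma subspace_cball_borel [measurable]:
  "subspace \<Gamma> \<Longrightarrow> subspace_cball \<Gamma> c R \<in> sets borel"
proof -
  assume "subspace \<Gamma>"
  then have "closed (\<Gamma> \<inter> cball c R)"
    using closed_subspace by blast
  moreover have "subspace_cball \<Gamma> c R = \<Gamma> \<inter> cball c R"
    by (auto simp: subspace_cball_def dist_norm norm_minus_commute)
  ultimately show ?thesis by simp
qed

text \<open>
  In orthonormal coordinates, the unit ball contains a small cube and is contained in the cube
  of side length 2. The two facts make the uniform distribution on the ball a probability measure.
\<close>
lemma emeasure_subspace_unit_cball: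
  fixes \<Gamma> :: "'a::euclidean_space set"
  assumes \<Gamma>: "subspace \<Gamma>"
  shows "emeasure (subspace_lborel \<Gamma>) (subspace_cball \<Gamma> 0 1) < \<infinity>"
    and "0 < emeasure (subspace_lborel \<Gamma>) (subspace_cball \<Gamma> 0 1)"
proof -
  obtain B where B: "orthonormal_basis_of \<Gamma> B" and
    M: "subspace_lborel \<Gamma> = distr (PiM B (\<lambda>_. lborel :: real measure)) borel (\<lambda>c. \<Sum>b\<in>B. c b *\<^sub>R b)"
    using subspace_lborel_obtain_basis[OF \<Gamma>] by blast
  note fin = orthonormal_basis_of_finite_card(1)[OF B]
  interpret product_sigma_finite "\<lambda>_::'a. lborel :: real measure"
    by standard
  define P where "P = PiM B (\<lambda>_. lborel :: real measure)"
  define \<phi> where "\<phi> c = (\<Sum>b\<in>B. c b *\<^sub>R b)" for c :: "'a \<Rightarrow> real"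
  have \<phi>[measurable]: "\<phi> \<in> measurable P borel"
    unfolding \<phi>_def P_def by measurable
  define U where "U = \<phi> -` subspace_cball \<Gamma> 0 1 \<inter> space P"
  have U[measurable]: "U \<in> sets P"
    unfolding U_def using subspace_cball_borel[OF \<Gamma>] \<phi> by (auto intro: measurable_sets)
  have eq: "emeasure (subspace_lborel \<Gamma>) (subspace_cball \<Gamma> 0 1) = emeasure P U"
    unfolding M P_def[symmetric] \<phi>_def[symmetric] U_def
    using subspace_cball_borel[OF \<Gamma>] by (simp add: emeasure_distr)
  have unit: "norm b = 1" and orth: "b' \<in> B \<Longrightarrow> b \<noteq> b' \<Longrightarrow> b \<bullet> b' = 0" if "b \<in> B" for b b'
    using B that by (auto simp: orthonormal_basis_of_def pairwise_def orthogonal_def)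
  have coord: "\<phi> c \<bullet> b = c b" if "b \<in> B" for b c
  proof -
    have "\<phi> c \<bullet> b = (\<Sum>b'\<in>B. if b' = b then c b else 0)"
      unfolding \<phi>_def inner_sum_left using that unit orth
      by (intro sum.cong) (auto simp: norm_eq_1)
    then show ?thesis using fin that by simp
  qed
  have box: "emeasure P (\<Pi>\<^sub>E b\<in>B. {u..v}) = ennreal ((v - u) ^ card B)" if "u \<le> v" for u v
    unfolding P_def using that by (subst emeasure_PiM[OF fin]) (auto simp: ennreal_power)
  have "U \<subseteq> (\<Pi>\<^sub>E b\<in>B. {-1..1})"
  proof
    fix c assume "c \<in> U"
    then have c: "norm (\<phi> c) \<le> 1" "c \<in> extensional B"
      by (auto simp: U_def subspace_cball_def P_def space_PiM PiE_def)
    have "\<bar>c b\<bar> \<le> 1" if "b \<in> B" for b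
      using Cauchy_Schwarz_ineq2[of "\<phi> c" b] coord[OF that] unit[OF that] c(1) by simp
    then show "c \<in> (\<Pi>\<^sub>E b\<in>B. {-1..1})"
      using c(2) by (auto simp: PiE_iff abs_le_iff minus_le_iff)
  qed
  then have "emeasure P U \<le> emeasure P (\<Pi>\<^sub>E b\<in>B. {-1..1})"
    by (intro emeasure_mono) (auto simp: P_def intro!: sets_PiM_I_finite fin)
  also have "\<dots> < \<infinity>"
    by (subst box) auto
  finally show "emeasure (subspace_lborel \<Gamma>) (subspace_cball \<Gamma> 0 1) < \<infinity>"
    unfolding eq .
  \<comment> \<open>Points of the cube with side \<open>e\<close> have norm at most \<open>card B * e\<close>, by the triangle inequality.
      The summand 1 covers an empty basis.\<close>
  define e where "e = 1 / (1 + real (card B))"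
  have e: "0 < e" "real (card B) * e \<le> 1" by (auto simp: e_def field_simps)
  have "(\<Pi>\<^sub>E b\<in>B. {0..e}) \<subseteq> U"
  proof
    fix c assume c: "c \<in> (\<Pi>\<^sub>E b\<in>B. {0..e})"
    have "norm (\<phi> c) \<le> (\<Sum>b\<in>B. e)"
      unfolding \<phi>_def using c unit by (intro sum_norm_le) (auto simp: PiE_iff)
    moreover have "\<phi> c \<in> \<Gamma>"
    proof -
      have "\<phi> c \<in> span B"
        unfolding \<phi>_def by (intro span_sum span_scale span_base)
      then show ?thesis using B by (simp add: orthonormal_basis_of_def)
    qed
    ultimately show "c \<in> U"
      using c e by (auto simp: U_def subspace_cball_def P_def space_PiM PiE_iff)
  qed
  then have "emeasure P (\<Pi>\<^sub>E b\<in>B. {0..e}) \<le> emeasure P U"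
    by (intro emeasure_mono U)
  moreover have "0 < emeasure P (\<Pi>\<^sub>E b\<in>B. {0..e})"
    using e by (subst box) auto
  ultimately show "0 < emeasure (subspace_lborel \<Gamma>) (subspace_cball \<Gamma> 0 1)"
    unfolding eq by simp
qed

section \<open>Volumes of balls in a subspace\<close>

lemma subspace_cball_measure:
  fixes \<Gamma> :: "'a::euclidean_space set"
  assumes \<Gamma>: "subspace \<Gamma>" and c: "c \<in> \<Gamma>" and R: "0 < R"
  shows "emeasure (subspace_lborel \<Gamma>) (subspace_cball \<Gamma> c R) < \<infinity>"
    and "measure (subspace_lborel \<Gamma>) (subspace_cball \<Gamma> c R)
      = R ^ dim \<Gamma> * measure (subspace_lborel \<Gamma>) (subspace_cball \<Gamma> 0 1)"
proof -
  have "R *\<^sub>R v + c \<in> \<Gamma> \<longleftrightarrow> v \<in> \<Gamma>" for v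
  proof
    assume "R *\<^sub>R v + c \<in> \<Gamma>"
    then have "(1 / R) *\<^sub>R ((R *\<^sub>R v + c) - c) \<in> \<Gamma>"
      using c by (intro subspace_scale[OF \<Gamma>] subspace_diff[OF \<Gamma>])
    then show "v \<in> \<Gamma>" using R by simp
  qed (use \<Gamma> c in \<open>auto intro: subspace_add subspace_scale\<close>)
  then have "{v. R *\<^sub>R v + c \<in> subspace_cball \<Gamma> c R} = subspace_cball \<Gamma> 0 1"
    using R by (auto simp: subspace_cball_def)
  then have eq: "emeasure (subspace_lborel \<Gamma>) (subspace_cball \<Gamma> c R)
      = ennreal (R ^ dim \<Gamma>) * emeasure (subspace_lborel \<Gamma>) (subspace_cball \<Gamma> 0 1)"
    using emeasure_subspace_lborel_affine[OF \<Gamma> R c subspace_cball_borel[OF \<Gamma>]] by metis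
  then show "emeasure (subspace_lborel \<Gamma>) (subspace_cball \<Gamma> c R) < \<infinity>"
    using emeasure_subspace_unit_cball(1)[OF \<Gamma>] by (simp add: ennreal_mult_less_top)
  show "measure (subspace_lborel \<Gamma>) (subspace_cball \<Gamma> c R)
      = R ^ dim \<Gamma> * measure (subspace_lborel \<Gamma>) (subspace_cball \<Gamma> 0 1)"
    using R by (simp add: measure_def eq enn2real_mult)
qed

lemma measure_subspace_unit_cball_pos:
  "subspace \<Gamma> \<Longrightarrow> 0 < measure (subspace_lborel \<Gamma>) (subspace_cball \<Gamma> 0 1)"
  using emeasure_subspace_unit_cball[of \<Gamma>]
  by (simp add: measure_def enn2real_positive_iff)

lemma measure_diff_concentric_cballs:
  fixes \<Gamma> :: "'a::euclidean_space set"
  assumes \<Gamma>: "subspace \<Gamma>" and c: "c \<in> \<Gamma>" and R: "0 < R1" "R1 \<le> R2"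
  shows "measure (subspace_lborel \<Gamma>) (subspace_cball \<Gamma> c R2 - subspace_cball \<Gamma> c R1)
    = (R2 ^ dim \<Gamma> - R1 ^ dim \<Gamma>) * measure (subspace_lborel \<Gamma>) (subspace_cball \<Gamma> 0 1)"
proof -
  have "subspace_cball \<Gamma> c R1 \<subseteq> subspace_cball \<Gamma> c R2"
    using R by (auto simp: subspace_cball_def)
  then have "measure (subspace_lborel \<Gamma>) (subspace_cball \<Gamma> c R2 - subspace_cball \<Gamma> c R1)
      = measure (subspace_lborel \<Gamma>) (subspace_cball \<Gamma> c R2)
        - measure (subspace_lborel \<Gamma>) (subspace_cball \<Gamma> c R1)"
    using subspace_cball_measure(1)[OF \<Gamma> c, of R2] subspace_cball_borel[OF \<Gamma>] R
    by (intro measure_Diff) auto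
  then show ?thesis
    using subspace_cball_measure(2)[OF \<Gamma> c] R by (simp add: left_diff_distrib)
qed

text \<open>
  The midpoint \<open>h / 2\<close> is at distance \<open>norm h / 2\<close> from both centres. A point of one
  ball only is therefore within \<open>1 + norm h / 2\<close> of the midpoint by its distance to the nearer centre,
  and beyond \<open>1 - norm h / 2\<close> by its distance to the other.
\<close>
lemma subspace_cball_sym_diff_subset:
  "sym_diff (subspace_cball \<Gamma> 0 1) (subspace_cball \<Gamma> h 1)
    \<subseteq> subspace_cball \<Gamma> ((1 / 2) *\<^sub>R h) (1 + norm h / 2)
      - subspace_cball \<Gamma> ((1 / 2) *\<^sub>R h) (1 - norm h / 2)"
proof
  fix v assume v: "v \<in> sym_diff (subspace_cball \<Gamma> 0 1) (subspace_cball \<Gamma> h 1)"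
  let ?w = "v - (1 / 2) *\<^sub>R h"
  have "v - h - ?w = - ((1 / 2) *\<^sub>R h)"
    by (simp add: algebra_simps flip: scaleR_add_left)
  then have "\<bar>norm v - norm ?w\<bar> \<le> norm h / 2" "\<bar>norm (v - h) - norm ?w\<bar> \<le> norm h / 2"
    using norm_triangle_ineq3[of v ?w] norm_triangle_ineq3[of "v - h" ?w] by auto
  then show "v \<in> subspace_cball \<Gamma> ((1 / 2) *\<^sub>R h) (1 + norm h / 2)
      - subspace_cball \<Gamma> ((1 / 2) *\<^sub>R h) (1 - norm h / 2)"
    using v unfolding abs_le_iff by (auto simp: subspace_cball_def)
qed

section \<open>Averages over the unit ball\<close>

lemma uniform_measure_subspace_cball_prob:
  assumes "subspace \<Gamma>"
  shows "prob_space (uniform_measure (subspace_lborel \<Gamma>) (subspace_cball \<Gamma> 0 1))"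
  using emeasure_subspace_unit_cball[OF assms] by (intro prob_space_uniform_measure) auto

lemma AE_uniform_measure_subspace_cball:
  assumes "subspace \<Gamma>"
  shows "AE v in uniform_measure (subspace_lborel \<Gamma>) (subspace_cball \<Gamma> 0 1). norm v \<le> 1"
proof (rule AE_uniform_measureI)
  show "subspace_cball \<Gamma> 0 1 \<in> sets (subspace_lborel \<Gamma>)"
    using subspace_cball_borel[OF assms] by simp
qed (auto simp: subspace_cball_def)

lemma integrable_uniform_measure_subspace_cball:
  fixes \<phi> :: "'a::euclidean_space \<Rightarrow> real"
  assumes \<Gamma>: "subspace \<Gamma>" and \<phi>: "continuous_on UNIV \<phi>"
  shows "integrable (uniform_measure (subspace_lborel \<Gamma>) (subspace_cball \<Gamma> 0 1)) \<phi>"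
proof -
  interpret prob_space "uniform_measure (subspace_lborel \<Gamma>) (subspace_cball \<Gamma> 0 1)"
    by (rule uniform_measure_subspace_cball_prob[OF \<Gamma>])
  have "compact (\<phi> ` cball 0 1)"
    by (intro compact_continuous_image continuous_on_subset[OF \<phi>]) auto
  then obtain C where C: "\<And>v. norm v \<le> 1 \<Longrightarrow> \<bar>\<phi> v\<bar> \<le> C"
    by (fastforce dest!: compact_imp_bounded simp: bounded_iff)
  show ?thesis
  proof (rule integrable_const_bound[where B = C])
    show "\<phi> \<in> borel_measurable (uniform_measure (subspace_lborel \<Gamma>) (subspace_cball \<Gamma> 0 1))"
      using borel_measurable_continuous_onI[OF \<phi>]
      by (simp cong: measurable_cong_sets)
    show "AE v in uniform_measure (subspace_lborel \<Gamma>) (subspace_cball \<Gamma> 0 1). norm (\<phi> v) \<le> C"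
      using AE_uniform_measure_subspace_cball[OF \<Gamma>] by eventually_elim (auto intro: C)
  qed
qed

lemma uniform_average_diff_le:
  fixes \<phi> \<psi> :: "'a::euclidean_space \<Rightarrow> real"
  assumes \<Gamma>: "subspace \<Gamma>" and \<phi>: "continuous_on UNIV \<phi>" and \<psi>: "continuous_on UNIV \<psi>"
    and c: "\<And>v. norm v \<le> 1 \<Longrightarrow> \<bar>\<phi> v - \<psi> v\<bar> \<le> c"
  defines "N \<equiv> uniform_measure (subspace_lborel \<Gamma>) (subspace_cball \<Gamma> 0 1)"
  shows "\<bar>(\<integral>v. \<phi> v \<partial>N) - (\<integral>v. \<psi> v \<partial>N)\<bar> \<le> c"
proof -
  interpret prob_space N
    unfolding N_def by (rule uniform_measure_subspace_cball_prob[OF \<Gamma>])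
  note int = integrable_uniform_measure_subspace_cball[OF \<Gamma> \<phi>, folded N_def]
    integrable_uniform_measure_subspace_cball[OF \<Gamma> \<psi>, folded N_def]
  have "\<bar>(\<integral>v. \<phi> v \<partial>N) - (\<integral>v. \<psi> v \<partial>N)\<bar> = \<bar>\<integral>v. \<phi> v - \<psi> v \<partial>N\<bar>"
    using int by simp
  also have "\<dots> \<le> (\<integral>v. \<bar>\<phi> v - \<psi> v\<bar> \<partial>N)"
    by (rule integral_abs_bound)
  also have "\<dots> \<le> (\<integral>v. c \<partial>N)"
  proof (rule integral_mono_AE)
    show "AE v in N. \<bar>\<phi> v - \<psi> v\<bar> \<le> c"
      using AE_uniform_measure_subspace_cball[OF \<Gamma>, folded N_def] by eventually_elim (auto intro: c)
  qed (use int in auto)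
  also have "\<dots> = c"
    by (simp add: prob_space)
  finally show ?thesis .
qed

lemma smoothing_alt_def:
  "smoothing \<delta> \<Gamma> f x
    = (\<integral>v. f (x + \<delta> *\<^sub>R v) \<partial>uniform_measure (subspace_lborel \<Gamma>) (subspace_cball \<Gamma> 0 1))"
  by (simp add: smoothing_def subspace_cball_def)

section \<open>Smoothing a bounded function\<close>

text \<open>
  The substitution \<open>v \<mapsto> v + h\<close> moves the translation from the integrand to the domain of
  integration. Comparing two translates then concerns one function on two different balls,
  and no modulus of continuity of \<open>g\<close> enters.
\<close>
lemma smoothing_translate:
  fixes \<Gamma> :: "'a::euclidean_space set" and g :: "'a \<Rightarrow> real"
  assumes \<Gamma>: "subspace \<Gamma>" and h: "h \<in> \<Gamma>" and g: "continuous_on UNIV g"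
  defines "M \<equiv> subspace_lborel \<Gamma>"
  shows "smoothing \<delta> \<Gamma> g (x + \<delta> *\<^sub>R h)
    = (\<integral>v. indicator (subspace_cball \<Gamma> h 1) v * g (x + \<delta> *\<^sub>R v) \<partial>M)
      / measure M (subspace_cball \<Gamma> 0 1)"
proof -
  define K where "K = subspace_cball \<Gamma> 0 1"
  define m where "m = measure M K"
  have M[measurable_cong, simp]: "sets M = sets borel" "space M = UNIV"
    by (simp_all add: M_def)
  have [measurable]: "g \<in> borel_measurable borel"
    by (rule borel_measurable_continuous_onI[OF g])
  have K[measurable]: "K \<in> sets borel" "subspace_cball \<Gamma> h 1 \<in> sets borel"
    unfolding K_def by (rule subspace_cball_borel[OF \<Gamma>])+
  have m: "0 < m" "emeasure M K = ennreal m"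
    using measure_subspace_unit_cball_pos[OF \<Gamma>] emeasure_subspace_unit_cball(1)[OF \<Gamma>]
    by (auto simp: m_def M_def K_def emeasure_eq_ennreal_measure)
  have "indicator K v / emeasure M K = ennreal (indicator K v / m)" for v
    using m by (auto simp: indicator_def divide_ennreal simp flip: ennreal_1)
  then have N: "uniform_measure M K = density M (\<lambda>v. ennreal (indicator K v / m))"
    by (simp add: uniform_measure_def)
  have shift: "M = distr M borel (\<lambda>v. v + h)"
  proof (rule measure_eqI)
    fix A assume "A \<in> sets M"
    then have A: "A \<in> sets borel" by simp
    show "emeasure M A = emeasure (distr M borel (\<lambda>v. v + h)) A"
      using emeasure_subspace_lborel_affine[OF \<Gamma> zero_less_one h A] A
      unfolding M_def[symmetric] by (simp add: emeasure_distr vimage_def)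
  qed simp
  have K_shift: "indicator K v = (indicator (subspace_cball \<Gamma> h 1) (v + h) :: real)" for v
    using subspace_add[OF \<Gamma> _ h, of v] subspace_diff[OF \<Gamma> _ h, of "v + h"]
    by (auto simp: K_def subspace_cball_def indicator_def)
  have "smoothing \<delta> \<Gamma> g (x + \<delta> *\<^sub>R h)
      = (\<integral>v. (indicator K v / m) * g (x + \<delta> *\<^sub>R h + \<delta> *\<^sub>R v) \<partial>M)"
    unfolding smoothing_alt_def M_def[symmetric] K_def[symmetric] N
    using m by (subst integral_density) auto
  also have "\<dots> = (\<integral>v. indicator K v * g (x + \<delta> *\<^sub>R h + \<delta> *\<^sub>R v) \<partial>M) / m"
    by simp
  also have "(\<integral>v. indicator K v * g (x + \<delta> *\<^sub>R h + \<delta> *\<^sub>R v) \<partial>M)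
      = (\<integral>v. indicator (subspace_cball \<Gamma> h 1) (v + h) * g (x + \<delta> *\<^sub>R (v + h)) \<partial>M)"
    by (simp add: K_shift algebra_simps)
  also have "\<dots> = (\<integral>v. indicator (subspace_cball \<Gamma> h 1) v * g (x + \<delta> *\<^sub>R v) \<partial>distr M borel (\<lambda>v. v + h))"
    by (subst integral_distr) auto
  finally show ?thesis
    unfolding shift[symmetric] m_def K_def .
qed

text \<open>
  The two averages differ only through the values of \<open>g\<close> on the symmetric difference of two
  balls, which is covered by the shell around the midpoint of the centres. The condition
  \<open>norm h < 2\<close> keeps the inner radius of the shell positive.
\<close>
lemma smoothing_bounded_translation_estimate:
  fixes \<Gamma> :: "'a::euclidean_space set" and g :: "'a \<Rightarrow> real"
  assumes \<Gamma>: "subspace \<Gamma>" and h: "h \<in> \<Gamma>" "norm h < 2"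
    and g: "continuous_on UNIV g" and C: "\<And>y. \<bar>g y\<bar> \<le> C"
  shows "\<bar>smoothing \<delta> \<Gamma> g (x + \<delta> *\<^sub>R h) - smoothing \<delta> \<Gamma> g x\<bar>
    \<le> C * ((1 + norm h / 2) ^ dim \<Gamma> - (1 - norm h / 2) ^ dim \<Gamma>)"
proof -
  define M where "M = subspace_lborel \<Gamma>"
  define K where "K c = subspace_cball \<Gamma> c 1" for c
  define m where "m = measure M (K 0)"
  define \<psi> where "\<psi> v = g (x + \<delta> *\<^sub>R v)" for v
  define E where "E = subspace_cball \<Gamma> ((1 / 2) *\<^sub>R h) (1 + norm h / 2)
    - subspace_cball \<Gamma> ((1 / 2) *\<^sub>R h) (1 - norm h / 2)"
  have M[measurable_cong, simp]: "sets M = sets borel" "space M = UNIV"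
    by (simp_all add: M_def)
  have [measurable]: "g \<in> borel_measurable borel"
    by (rule borel_measurable_continuous_onI[OF g])
  have \<psi>[measurable]: "\<psi> \<in> borel_measurable M"
    unfolding \<psi>_def by measurable
  have K[measurable]: "K c \<in> sets borel" for c
    unfolding K_def by (rule subspace_cball_borel[OF \<Gamma>])
  have E[measurable]: "E \<in> sets borel"
    unfolding E_def by (intro sets.Diff subspace_cball_borel[OF \<Gamma>])
  have half: "(1 / 2) *\<^sub>R h \<in> \<Gamma>"
    using subspace_scale[OF \<Gamma> h(1)] .
  have E_sub: "E \<subseteq> subspace_cball \<Gamma> ((1 / 2) *\<^sub>R h) (1 + norm h / 2)"
    by (auto simp: E_def)
  have E_fin: "emeasure M E < \<infinity>"
  proof -
    have "emeasure M E \<le> emeasure M (subspace_cball \<Gamma> ((1 / 2) *\<^sub>R h) (1 + norm h / 2))"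
      using E_sub subspace_cball_borel[OF \<Gamma>] by (intro emeasure_mono) auto
    also have "\<dots> < \<infinity>"
      unfolding M_def by (intro subspace_cball_measure(1)[OF \<Gamma> half]) (simp add: add_pos_nonneg)
    finally show ?thesis .
  qed
  have m: "0 < m"
    unfolding m_def M_def K_def by (rule measure_subspace_unit_cball_pos[OF \<Gamma>])
  have int: "integrable M (\<lambda>v. indicator (K c) v * \<psi> v)" if "c \<in> \<Gamma>" for c
    using integrableI_bounded_set_indicator[of "K c" M \<psi> C] C
      subspace_cball_measure(1)[OF \<Gamma> that, of 1]
    by (simp add: K_def[symmetric] M_def[symmetric] \<psi>_def)
  have "smoothing \<delta> \<Gamma> g (x + \<delta> *\<^sub>R h) - smoothing \<delta> \<Gamma> g (x + \<delta> *\<^sub>R 0)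
      = (\<integral>v. indicator (K h) v * \<psi> v \<partial>M) / m - (\<integral>v. indicator (K 0) v * \<psi> v \<partial>M) / m"
    unfolding m_def \<psi>_def K_def M_def
    by (intro arg_cong2[where f = "(-)"] smoothing_translate \<Gamma> h g subspace_0)
  also have "\<dots> = (\<integral>v. indicator (K h) v * \<psi> v - indicator (K 0) v * \<psi> v \<partial>M) / m"
    using int[OF h(1)] int[OF subspace_0[OF \<Gamma>]] by (simp add: diff_divide_distrib)
  finally have "\<bar>smoothing \<delta> \<Gamma> g (x + \<delta> *\<^sub>R h) - smoothing \<delta> \<Gamma> g x\<bar>
      = \<bar>\<integral>v. indicator (K h) v * \<psi> v - indicator (K 0) v * \<psi> v \<partial>M\<bar> / m"
    using m by simp
  also have "\<dots> \<le> (\<integral>v. \<bar>indicator (K h) v * \<psi> v - indicator (K 0) v * \<psi> v\<bar> \<partial>M) / m"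
    using m by (intro divide_right_mono integral_abs_bound) auto
  also have "\<dots> \<le> (\<integral>v. C * indicator E v \<partial>M) / m"
  proof (intro divide_right_mono integral_mono)
    fix v
    have "v \<in> E" if "\<not> (v \<in> K h \<longleftrightarrow> v \<in> K 0)"
      using that subspace_cball_sym_diff_subset[of \<Gamma> h] by (auto simp: E_def K_def)
    moreover have "0 \<le> C"
      using C[of 0] by linarith
    ultimately show "\<bar>indicator (K h) v * \<psi> v - indicator (K 0) v * \<psi> v\<bar> \<le> C * indicator E v"
      using C[of "x + \<delta> *\<^sub>R v"] by (auto simp: indicator_def \<psi>_def)
  next
    show "integrable M (\<lambda>v. C * indicator E v)"
      using E_fin by (intro integrable_mult_right integrable_real_indicator) auto
    show "integrable M (\<lambda>v. \<bar>indicator (K h) v * \<psi> v - indicator (K 0) v * \<psi> v\<bar>)"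
      using int[OF h(1)] int[OF subspace_0[OF \<Gamma>]]
      by (intro integrable_abs Bochner_Integration.integrable_diff)
  qed (use m in auto)
  also have "\<dots> = C * measure M E / m"
    using E_fin by simp
  also have "measure M E = ((1 + norm h / 2) ^ dim \<Gamma> - (1 - norm h / 2) ^ dim \<Gamma>) * m"
    unfolding E_def M_def m_def K_def using h
    by (intro measure_diff_concentric_cballs[OF \<Gamma> half]) auto
  finally show ?thesis
    using m by simp
qed

lemma power_diff_le:
  fixes u w :: real
  assumes "0 \<le> w" "w \<le> u" "1 \<le> u"
  shows "u ^ n - w ^ n \<le> real n * (u - w) * u ^ n"
proof (induction n)
  case (Suc n)
  have "w ^ n \<le> u ^ n" "u ^ n \<le> u * u ^ n"
    using assms by (auto intro: power_mono simp: mult_le_cancel_right1)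
  then have "w ^ n \<le> u * u ^ n" by linarith
  have "u ^ Suc n - w ^ Suc n = u * (u ^ n - w ^ n) + (u - w) * w ^ n"
    by (simp add: algebra_simps)
  also have "\<dots> \<le> u * (real n * (u - w) * u ^ n) + (u - w) * (u * u ^ n)"
    using Suc assms \<open>w ^ n \<le> u * u ^ n\<close> by (intro add_mono mult_left_mono) auto
  finally show ?case
    by (simp add: algebra_simps)
qed simp

text \<open>
  The one-step estimate exceeds the linear bound by a factor of at most \<open>(1 + a / 2)^r\<close>, where
  \<open>a\<close> is the relative length of the step. Splitting \<open>p\<close> into \<open>n\<close> equal steps adds
  up the linear parts to the same total, while \<open>a\<close> tends to 0 with \<open>n\<close>, so the factor tends to 1.
\<close>
proposition smoothing_bounded_lipschitz_along:
  fixes \<Gamma> :: "'a::euclidean_space set" and g :: "'a \<Rightarrow> real"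
  assumes \<Gamma>: "subspace \<Gamma>" and \<delta>: "0 < \<delta>" and p: "p \<in> \<Gamma>"
    and g: "continuous_on UNIV g" and C: "\<And>y. \<bar>g y\<bar> \<le> C"
  shows "\<bar>smoothing \<delta> \<Gamma> g (x + p) - smoothing \<delta> \<Gamma> g x\<bar> \<le> (real (dim \<Gamma>) * C / \<delta>) * norm p"
proof -
  define S where "S = smoothing \<delta> \<Gamma> g"
  define r where "r = dim \<Gamma>"
  define a where "a n = norm p / \<delta> / real n" for n
  have C0: "0 \<le> C"
    using C[of 0] by linarith
  have a_lim: "a \<longlonglongrightarrow> 0"
    unfolding a_def by (rule lim_const_over_n)
  have estimate: "\<bar>S (x + p) - S x\<bar> \<le> (real r * C / \<delta>) * norm p * (1 + a n / 2) ^ r"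
    if n: "0 < n" "a n < 2" for n
  proof -
    define h where "h = (1 / (\<delta> * real n)) *\<^sub>R p"
    have h: "h \<in> \<Gamma>" "norm h = a n" "0 \<le> a n"
      using subspace_scale[OF \<Gamma> p] \<delta> by (auto simp: h_def a_def field_simps)
    have one: "\<bar>S (y + \<delta> *\<^sub>R h) - S y\<bar> \<le> C * (real r * a n * (1 + a n / 2) ^ r)" for y
    proof -
      have "\<bar>S (y + \<delta> *\<^sub>R h) - S y\<bar> \<le> C * ((1 + a n / 2) ^ r - (1 - a n / 2) ^ r)"
        unfolding S_def r_def h(2)[symmetric]
        by (rule smoothing_bounded_translation_estimate[OF \<Gamma> h(1) _ g C]) (use h n in simp)
      also have "\<dots> \<le> C * (real r * a n * (1 + a n / 2) ^ r)"
        using power_diff_le[of "1 - a n / 2" "1 + a n / 2" r] h n C0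
        by (intro mult_left_mono) auto
      finally show ?thesis .
    qed
    have "\<bar>S (x + real i *\<^sub>R (\<delta> *\<^sub>R h)) - S x\<bar> \<le> real i * (C * (real r * a n * (1 + a n / 2) ^ r))" for i
    proof (induction i)
      case (Suc i)
      have next_point: "x + real (Suc i) *\<^sub>R (\<delta> *\<^sub>R h)
          = (x + real i *\<^sub>R (\<delta> *\<^sub>R h)) + \<delta> *\<^sub>R h"
        by (simp add: algebra_simps)
      show ?case
        unfolding next_point
        using Suc one[of "x + real i *\<^sub>R (\<delta> *\<^sub>R h)"]
        unfolding of_nat_Suc distrib_right by linarith
    qed simp
    from this[of n] show ?thesis
      using n \<delta> by (simp add: h_def a_def mult_ac)
  qed
  have "(\<lambda>n. (real r * C / \<delta>) * norm p * (1 + a n / 2) ^ r)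
      \<longlonglongrightarrow> (real r * C / \<delta>) * norm p * (1 + 0 / 2) ^ r"
    by (intro tendsto_intros a_lim) auto
  moreover have "eventually (\<lambda>n. \<bar>S (x + p) - S x\<bar> \<le> (real r * C / \<delta>) * norm p * (1 + a n / 2) ^ r) sequentially"
    using order_tendstoD(2)[OF a_lim, of 2, simplified] eventually_gt_at_top[of 0]
    by eventually_elim (rule estimate)
  ultimately have "\<bar>S (x + p) - S x\<bar> \<le> (real r * C / \<delta>) * norm p * (1 + 0 / 2) ^ r"
    by (intro tendsto_lowerbound) auto
  then show ?thesis
    by (simp add: S_def r_def)
qed

section \<open>Smoothing a Lipschitz function\<close>

lemma smoothing_subspace_invariant:
  assumes "subspace_invariant \<Gamma> f"
  shows "subspace_invariant \<Gamma> (smoothing \<delta> \<Gamma> f)"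
  unfolding subspace_invariant_def
proof (intro allI ballI)
  fix x y assume "y \<in> \<Gamma>\<^sup>\<bottom>"
  then have "f (x + y + \<delta> *\<^sub>R v) = f (x + \<delta> *\<^sub>R v)" for v
    using assms unfolding subspace_invariant_def by (metis add.commute add.left_commute)
  then show "smoothing \<delta> \<Gamma> f x = smoothing \<delta> \<Gamma> f (x + y)"
    by (simp add: smoothing_def)
qed

lemma smoothing_lipschitz:
  fixes f :: "'a::euclidean_space \<Rightarrow> real"
  assumes \<Gamma>: "subspace \<Gamma>" and lip: "G-lipschitz_on UNIV f"
  shows "G-lipschitz_on UNIV (smoothing \<delta> \<Gamma> f)"
proof (rule lipschitz_onI)
  show "0 \<le> G" using lip by (rule lipschitz_on_nonneg)
  fix x y
  have cont: "continuous_on UNIV (\<lambda>v. f (z + \<delta> *\<^sub>R v))" for z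
    by (intro continuous_on_compose2[OF lipschitz_on_continuous_on[OF lip]] continuous_intros) auto
  show "dist (smoothing \<delta> \<Gamma> f x) (smoothing \<delta> \<Gamma> f y) \<le> G * dist x y"
    unfolding smoothing_alt_def dist_real_def
  proof (rule uniform_average_diff_le[OF \<Gamma> cont cont])
    fix v
    show "\<bar>f (x + \<delta> *\<^sub>R v) - f (y + \<delta> *\<^sub>R v)\<bar> \<le> G * dist x y"
      using lipschitz_onD[OF lip, of "x + \<delta> *\<^sub>R v" "y + \<delta> *\<^sub>R v"] by (simp add: dist_norm)
  qed
qed

lemma smoothing_close:
  fixes f :: "'a::euclidean_space \<Rightarrow> real"
  assumes \<Gamma>: "subspace \<Gamma>" and \<delta>: "0 \<le> \<delta>" and lip: "G-lipschitz_on UNIV f"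
  shows "\<bar>smoothing \<delta> \<Gamma> f x - f x\<bar> \<le> \<delta> * G"
proof -
  define N where "N = uniform_measure (subspace_lborel \<Gamma>) (subspace_cball \<Gamma> 0 1)"
  interpret prob_space N
    unfolding N_def by (rule uniform_measure_subspace_cball_prob[OF \<Gamma>])
  have cont: "continuous_on UNIV (\<lambda>v. f (x + \<delta> *\<^sub>R v))"
    by (intro continuous_on_compose2[OF lipschitz_on_continuous_on[OF lip]] continuous_intros) auto
  have "\<bar>(\<integral>v. f (x + \<delta> *\<^sub>R v) \<partial>N) - (\<integral>v. f x \<partial>N)\<bar> \<le> \<delta> * G"
    unfolding N_def
  proof (rule uniform_average_diff_le[OF \<Gamma> cont continuous_on_const])
    fix v :: 'a assume v: "norm v \<le> 1"
    have "\<bar>f (x + \<delta> *\<^sub>R v) - f x\<bar> \<le> (G * \<delta>) * norm v"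
      using lipschitz_onD[OF lip, of "x + \<delta> *\<^sub>R v" x] \<delta> by (simp add: dist_norm mult.assoc)
    also have "\<dots> \<le> (G * \<delta>) * 1"
      using v \<delta> lipschitz_on_nonneg[OF lip] by (intro mult_left_mono) auto
    finally show "\<bar>f (x + \<delta> *\<^sub>R v) - f x\<bar> \<le> \<delta> * G" by (simp add: mult.commute)
  qed
  then show ?thesis
    by (simp add: smoothing_alt_def N_def[symmetric] prob_space)
qed

text \<open>
  The smoothing of the increment \<open>f (y + k) - f y\<close>, which is bounded by \<open>G * norm k\<close>, is a first
  difference of \<open>F\<close>. Its increments along \<open>\<Gamma>\<close> are second differences of \<open>F\<close>, and the
  component of \<open>h\<close> orthogonal to \<open>\<Gamma>\<close> drops out by invariance.
\<close>
proposition smoothing_second_difference_bound: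
  fixes f :: "'a::euclidean_space \<Rightarrow> real"
  assumes \<Gamma>: "subspace \<Gamma>" and \<delta>: "0 < \<delta>"
    and inv: "subspace_invariant \<Gamma> f" and lip: "G-lipschitz_on UNIV f"
  defines "F \<equiv> smoothing \<delta> \<Gamma> f"
  shows "\<bar>F (x + h + k) - F (x + h) - F (x + k) + F x\<bar>
    \<le> (real (dim \<Gamma>) * G / \<delta>) * norm h * norm k"
proof -
  have G: "0 \<le> G" using lip by (rule lipschitz_on_nonneg)
  obtain p q where p: "p \<in> \<Gamma>" and q: "\<And>w. w \<in> \<Gamma> \<Longrightarrow> orthogonal q w" and h: "h = p + q"
    using orthogonal_subspace_decomp_exists[of \<Gamma> h] \<Gamma> by (metis span_eq_iff)
  have F_inv: "F (y + q) = F y" for y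
  proof -
    have "q \<in> \<Gamma>\<^sup>\<bottom>"
      using q by (auto simp: orthogonal_comp_def orthogonal_commute)
    then show ?thesis
      using smoothing_subspace_invariant[OF inv, of \<delta>]
      unfolding F_def subspace_invariant_def by metis
  qed
  have norm_p: "norm p \<le> norm h"
  proof -
    have "(norm h)\<^sup>2 = (norm p)\<^sup>2 + (norm q)\<^sup>2"
      unfolding h using q[OF p] by (intro norm_add_Pythagorean) (simp add: orthogonal_commute)
    then show ?thesis
      by (simp add: power2_le_imp_le)
  qed
  define g where "g y = f (y + k) - f y" for y
  have f_cont: "continuous_on UNIV f"
    by (rule lipschitz_on_continuous_on[OF lip])
  have cont: "continuous_on UNIV (\<lambda>v. f (z + \<delta> *\<^sub>R v))" for z
    by (intro continuous_on_compose2[OF f_cont] continuous_intros) auto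
  have g_cont: "continuous_on UNIV g"
    unfolding g_def by (intro continuous_intros f_cont continuous_on_compose2[OF f_cont]) auto
  have g_bound: "\<bar>g y\<bar> \<le> G * norm k" for y
    using lipschitz_onD[OF lip, of "y + k" y] by (simp add: g_def dist_norm)
  have Sg: "smoothing \<delta> \<Gamma> g y = F (y + k) - F y" for y
  proof -
    have shift: "y + \<delta> *\<^sub>R v + k = y + k + \<delta> *\<^sub>R v" for v
      by (simp add: algebra_simps)
    show ?thesis
      unfolding F_def smoothing_alt_def g_def shift
      by (intro Bochner_Integration.integral_diff integrable_uniform_measure_subspace_cball \<Gamma> cont)
  qed
  have "F (x + h + k) = F (x + p + k)" "F (x + h) = F (x + p)"
    using F_inv[of "x + p + k"] F_inv[of "x + p"] by (simp_all add: h algebra_simps)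
  then have "\<bar>F (x + h + k) - F (x + h) - F (x + k) + F x\<bar>
      = \<bar>smoothing \<delta> \<Gamma> g (x + p) - smoothing \<delta> \<Gamma> g x\<bar>"
    by (simp add: Sg)
  also have "\<dots> \<le> (real (dim \<Gamma>) * (G * norm k) / \<delta>) * norm p"
    by (rule smoothing_bounded_lipschitz_along[OF \<Gamma> \<delta> p g_cont g_bound])
  also have "\<dots> \<le> (real (dim \<Gamma>) * (G * norm k) / \<delta>) * norm h"
    using norm_p G \<delta> by (intro mult_left_mono) auto
  finally show ?thesis
    by (simp add: mult_ac)
qed

theorem lemma2p3:
  fixes \<Gamma> :: "(real ^ 'd) set" and f :: "real ^ 'd \<Rightarrow> real"
    and r :: nat and \<delta> G :: real
  assumes "subspace \<Gamma>" and "dim \<Gamma> = r" and "r \<ge> 1"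
    and "\<delta> > 0"
    and "subspace_invariant \<Gamma> f"
    and "G-lipschitz_on UNIV f"
  shows "((\<forall>x. smoothing \<delta> \<Gamma> f differentiable (at x)) \<and>
          G-lipschitz_on UNIV (smoothing \<delta> \<Gamma> f) \<and>
          subspace_invariant \<Gamma> (smoothing \<delta> \<Gamma> f)) \<and>
         (real r * G / \<delta>)-lipschitz_on UNIV (gradient (smoothing \<delta> \<Gamma> f)) \<and>
         (\<forall>x. \<bar>smoothing \<delta> \<Gamma> f x - f x\<bar> \<le> \<delta> * G)"
proof -
  note \<Gamma> = assms(1) and r = assms(2) and \<delta> = assms(4) and inv = assms(5) and lip = assms(6)
  have L: "0 \<le> real r * G / \<delta>"
    using \<delta> lipschitz_on_nonneg[OF lip] by simp
  note second = smoothing_second_difference_bound[OF \<Gamma> \<delta> inv lip, unfolded r]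
  note F_lip = smoothing_lipschitz[OF \<Gamma> lip, of \<delta>]
  show ?thesis
    using second_difference_bound_imp_lipschitz_gradient[OF second L F_lip]
      F_lip smoothing_subspace_invariant[OF inv] smoothing_close[OF \<Gamma> _ lip] \<delta>
    by auto
qed

end
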